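(* Let $L$ be a link and let $L'$ be a sublink of $L$. Let $\Lambda$ and $\Lambda'$ be the linking matrices of $L$ and $L'$ respectively, and let $\mathcal{M}(\Lambda)$ and $\mathcal{M}(\Lambda')$ be the resulting total Milnor quotients. Then there is a surjective group homomorphism $\mathcal{M}(\Lambda)\twoheadrightarrow\mathcal{M}(\Lambda')$.
   Context: Links are oriented links in $S^3$ with ordered components; a sublink is a union of some of the components. The linking matrix of an $n$-component link $L=L_1\cup\dots\cup L_n$ is the $n\times n$ symmetric integer matrix $\Lambda$ with zeros on the main diagonal and $\Lambda_{ij}=\operatorname{lk}(L_i,L_j)$ for $i\neq j$. For any symmetric $n\times n$ integer matrix $\Lambda$ with zeros on the main diagonal, the total Milnor quotient is defined as follows. Let $e_1,\dots,e_n$ be the standard basis of $\mathbb{Z}^n$ and put $X^{ijk}=e_i\wedge e_j\wedge e_k$ in the third exterior power $\mathbb{Z}^n\wedge\mathbb{Z}^n\wedge\mathbb{Z}^n\cong\mathbb{Z}^{\binom n3}$, with basis $\{X^{ijk}:1\le i<j<k\le n\}$. For $1\le j\ne k\le n$ let $v_{jk}=\sum_{i=1}^n \Lambda_{ik}X^{ijk}$, and let $V(\Lambda)$ be the subgroup generated by all $v_{jk}$, $1\le j\ne k\le n$. Then $\mathcal{M}(\Lambda)=\mathbb{Z}^{\binom n3}/V(\Lambda)$. *)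

theory Defs
  imports
    "HOL-Homology.Homology"
    "HOL-Algebra.Free_Abelian_Groups"
    "HOL-Library.Sublist"
    "Jordan_Normal_Form.Matrix"
begin

section \<open>Links in the 3-sphere\<close>

text \<open>
  An oriented knot is given by a parametrisation of it by the standardly oriented circle
  \<^term>\<open>nsphere 1\<close>; only the values on the circle matter. Tameness is imposed as local flatness.
  This covers smooth and piecewise linear knots and excludes wild ones.
\<close>

type_synonym curve = "(nat \<Rightarrow> real) \<Rightarrow> (nat \<Rightarrow> real)"

definition curve_image :: "curve \<Rightarrow> (nat \<Rightarrow> real) set" where
  "curve_image K = K ` topspace (nsphere 1)"

definition locally_flat :: "(nat \<Rightarrow> real) set \<Rightarrow> bool" where
  "locally_flat C \<longleftrightarrow>
     (\<forall>x\<in>C. \<exists>U h. openin (nsphere 3) U \<and> x \<in> U \<and>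
        homeomorphic_map (subtopology (nsphere 3) U) (Euclidean_space 3) h \<and>
        h ` (U \<inter> C) = topspace (Euclidean_space 1))"

definition knot :: "curve \<Rightarrow> bool" where
  "knot K \<longleftrightarrow> embedding_map (nsphere 1) (nsphere 3) K \<and> locally_flat (curve_image K)"

text \<open>The list order is the order of the components.\<close>

definition link :: "curve list \<Rightarrow> bool" where
  "link L \<longleftrightarrow> (\<forall>K\<in>set L. knot K) \<and>
     (\<forall>i<length L. \<forall>j<length L. i \<noteq> j \<longrightarrow> disjnt (curve_image (L ! i)) (curve_image (L ! j)))"

text \<open>A union of some of the components, in the induced order.\<close>

definition sublink :: "curve list \<Rightarrow> curve list \<Rightarrow> bool" where
  "sublink L' L \<longleftrightarrow> subseq L' L"


section \<open>Linking numbers\<close>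

text \<open>
  The linking number of disjoint closed curves \<open>f\<close>, \<open>g\<close> in \<open>S\<^sup>3 = \<partial>D\<^sup>4\<close> is the degree of the
  self-map of \<open>S\<^sup>3\<close> (viewed as the join of two circles) that sends \<open>(r u, s v)\<close>, where \<open>u\<close>, \<open>v\<close>
  are points of the circle, \<open>r, s \<ge> 0\<close> and \<open>r\<^sup>2 + s\<^sup>2 = 1\<close>, to the normalisation of
  \<open>r f u - s g v\<close>. This is the analogue in \<open>S\<^sup>3\<close> of the degree of the Gauss map
  \<open>(u, v) \<mapsto> (f u - g v) / |f u - g v|\<close> for curves in Euclidean 3-space. Equivalently, it is the
  algebraic intersection number in \<open>D\<^sup>4\<close> of the two discs obtained by coning \<open>f\<close> and \<open>g\<close> (made
  transverse away from the boundary), since \<open>(a, b) \<mapsto> A a - B b\<close> has local degree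
  \<open>det [dA, -dB] = det [dA, dB]\<close> at an intersection point of discs \<open>A\<close> and \<open>B\<close>.
  When \<open>r = 0\<close> the value \<open>f (...)\<close> is irrelevant, as it is multiplied by 0; likewise for \<open>s\<close>.
\<close>

definition join_diff :: "curve \<Rightarrow> curve \<Rightarrow> (nat \<Rightarrow> real) \<Rightarrow> (nat \<Rightarrow> real)" where
  "join_diff f g x =
     (let r = sqrt ((x 0)\<^sup>2 + (x 1)\<^sup>2); s = sqrt ((x 2)\<^sup>2 + (x 3)\<^sup>2);
          u = (\<lambda>j. if j < 2 then x j / r else 0);
          v = (\<lambda>j. if j < 2 then x (j + 2) / s else 0)
      in (\<lambda>i. r * f u i - s * g v i))"

definition normalise :: "(nat \<Rightarrow> real) \<Rightarrow> (nat \<Rightarrow> real)" where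
  "normalise y = (\<lambda>i. y i / sqrt (\<Sum>j\<le>3. (y j)\<^sup>2))"

definition linking_number :: "curve \<Rightarrow> curve \<Rightarrow> int" where
  "linking_number f g = Brouwer_degree2 3 (\<lambda>x. normalise (join_diff f g x))"

definition linking_matrix :: "curve list \<Rightarrow> int mat" where
  "linking_matrix L = mat (length L) (length L)
     (\<lambda>(i, j). if i = j then 0 else linking_number (L ! i) (L ! j))"

lemma nsphere_top_of_set:
  "nsphere n = top_of_set {x. (\<Sum>i\<le>n. x i ^ 2) = 1 \<and> (\<forall>i>n. x i = 0)}"
  by (simp add: nsphere euclidean_product_topology)

lemma topspace_nsphere3:
  "topspace (nsphere 3) = {x. (x 0)\<^sup>2 + (x 1)\<^sup>2 + (x 2)\<^sup>2 + (x 3)\<^sup>2 = 1 \<and> (\<forall>i>3. x i = 0)}"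
  by (simp add: nsphere_top_of_set eval_nat_numeral)

lemma topspace_nsphere1:
  "topspace (nsphere 1) = {x. (x 0)\<^sup>2 + (x 1)\<^sup>2 = 1 \<and> (\<forall>i>1. x i = 0)}"
  by (simp add: nsphere_top_of_set)

lemma cont_if: "(b \<Longrightarrow> continuous_on S f) \<Longrightarrow> (\<not> b \<Longrightarrow> continuous_on S g)
   \<Longrightarrow> continuous_on S (\<lambda>x. if b then f x else g x)"
  by (cases b) auto

lemma cont_snd: "continuous_on S (\<lambda>p::real \<times> (nat \<Rightarrow> real). snd p i)"
  by (rule continuous_on_product_then_coordinatewise) (intro continuous_intros)

lemma rot_sq: "(c * p - s * q)\<^sup>2 + (s * p + c * q)\<^sup>2 = (s\<^sup>2 + c\<^sup>2) * (p\<^sup>2 + q\<^sup>2)"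
  "(c * p + s * q)\<^sup>2 + (c * q - s * p)\<^sup>2 = (s\<^sup>2 + c\<^sup>2) * (p\<^sup>2 + q\<^sup>2)" for c s p q :: real
  by (simp_all add: power2_eq_square algebra_simps)

lemma nsphere3_homotopic_id_degree:
  assumes h: "\<And>i. continuous_on UNIV (\<lambda>p. h (fst p) (snd p) i)"
    and im: "\<And>t x. x \<in> topspace (nsphere 3) \<Longrightarrow> h t x \<in> topspace (nsphere 3)"
    and 0: "\<And>x. x \<in> topspace (nsphere 3) \<Longrightarrow> h 0 x = x"
    and 1: "\<And>x. x \<in> topspace (nsphere 3) \<Longrightarrow> h (1::real) x = f x"
  shows "Brouwer_degree2 3 f = 1 \<and> continuous_map (nsphere 3) (nsphere 3) f"
proof -
  have c: "continuous_on UNIV (\<lambda>p. h (fst p) (snd p))"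
    using h by (rule continuous_on_coordinatewise_then_product)
  have "continuous_map (prod_topology (top_of_set {0..1}) (nsphere 3)) (nsphere 3)
           (\<lambda>p. h (fst p) (snd p))"
    using im continuous_on_subset[OF c]
    by (auto simp: nsphere_top_of_set[of 3] subset_iff)
  then have "homotopic_with (\<lambda>x. True) (nsphere 3) (nsphere 3) (h 0) (h 1)"
    unfolding homotopic_with_def by (intro exI[of _ "\<lambda>p. h (fst p) (snd p)"]) auto
  then have H: "homotopic_with (\<lambda>x. True) (nsphere 3) (nsphere 3) id f"
    by (rule homotopic_with_eq) (auto simp: 0 1)
  show ?thesis
    using homotopic_with_imp_continuous_maps[OF H] Brouwer_degree2_homotopic[OF H] by simp
qed

lemma normalise_id: "x \<in> topspace (nsphere 3) \<Longrightarrow> normalise x = x"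
  by (simp add: normalise_def nsphere_top_of_set)

text \<open>The positive Hopf link has linking number 1, which pins down the sign convention.\<close>

lemma linking_number_Hopf:
  "linking_number (\<lambda>u i. if i < 2 then u i else 0)
     (\<lambda>v i. if i = 2 then v 0 else if i = 3 then v 1 else 0) = 1"
proof -
  let ?h = "\<lambda>(t::real) (x::nat \<Rightarrow> real) (i::nat). if i = 2 then cos (pi * t) * x 2 - sin (pi * t) * x 3
     else if i = 3 then sin (pi * t) * x 2 + cos (pi * t) * x 3 else (x i :: real)"
  show ?thesis unfolding linking_number_def
  proof (rule nsphere3_homotopic_id_degree[where h = ?h, THEN conjunct1])
    fix t and x :: "nat \<Rightarrow> real"
    assume x: "x \<in> topspace (nsphere 3)"
    have "(cos a * p - sin a * q)\<^sup>2 + (sin a * p + cos a * q)\<^sup>2 = p\<^sup>2 + q\<^sup>2" for a p q :: real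
      by (simp add: rot_sq)
    from this[of "pi * t" "x 2" "x 3"] show s: "?h t x \<in> topspace (nsphere 3)"
      using x by (simp add: topspace_nsphere3)
  next
    fix x :: "nat \<Rightarrow> real"
    assume x: "x \<in> topspace (nsphere 3)"
    have y: "(\<lambda>i. if i = 2 \<or> i = 3 then - x i else x i) \<in> topspace (nsphere 3)"
      using x by (simp add: topspace_nsphere3)
    have e: "i = 0 \<or> i = 1 \<or> i = 2 \<or> i = 3 \<or> i > 3" for i :: nat by linarith
    have n: "x i = 0" if "i > 3" for i using x that by (simp add: topspace_nsphere3)
    have "join_diff (\<lambda>u i. if i < 2 then u i else 0)
        (\<lambda>v i. if i = 2 then v 0 else if i = 3 then v 1 else 0) x
      = (\<lambda>i. if i = 2 \<or> i = 3 then - x i else x i)"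
    proof
      fix i :: nat
      have *: "sqrt (p\<^sup>2 + q\<^sup>2) = 0 \<Longrightarrow> p = 0 \<and> q = 0" for p q :: real
        by (simp add: sum_power2_eq_zero_iff)
      show "join_diff (\<lambda>u i. if i < 2 then u i else 0)
        (\<lambda>v i. if i = 2 then v 0 else if i = 3 then v 1 else 0) x i
      = (if i = 2 \<or> i = 3 then - x i else x i)"
        using e[of i] *[of "x 0" "x 1"] *[of "x 2" "x 3"] n[of i]
        by (auto simp: join_diff_def Let_def field_simps) (simp_all add: eval_nat_numeral)
    qed
    then show "?h 1 x = normalise (join_diff (\<lambda>u i. if i < 2 then u i else 0)
        (\<lambda>v i. if i = 2 then v 0 else if i = 3 then v 1 else 0) x)"
      using normalise_id[OF y] by auto
  next
    fix i show "continuous_on UNIV (\<lambda>p. ?h (fst p) (snd p) i)"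
      by (intro cont_if continuous_intros cont_snd)
  qed auto
qed

lemma continuous_on_radial:
  fixes F :: "(nat \<Rightarrow> real) \<Rightarrow> real" and S :: "(nat \<Rightarrow> real) set"
  assumes r: "continuous_on S r" and G: "continuous_on {x \<in> S. r x > 0} G"
    and b: "\<And>x. x \<in> S \<Longrightarrow> r x > 0 \<Longrightarrow> \<bar>G x\<bar> \<le> 1" and pos: "\<And>x. x \<in> S \<Longrightarrow> r x \<ge> 0"
  shows "continuous_on S (\<lambda>x. (r x * G x) :: real)"
  unfolding continuous_on_def
proof
  fix x assume x: "x \<in> S"
  show "((\<lambda>x. r x * G x) \<longlongrightarrow> r x * G x) (at x within S)"
  proof (cases "r x = 0")
    case True
    have "(r \<longlongrightarrow> 0) (at x within S)" using r x True by (metis continuous_on_def)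
    moreover have "\<forall>\<^sub>F y in at x within S. norm (r y * G y) \<le> r y"
      unfolding eventually_at_filter
    proof (intro always_eventually allI impI)
      fix y assume "y \<in> S"
      then show "norm (r y * G y) \<le> r y"
        using b[of y] pos[of y] by (cases "r y = 0") (auto simp: abs_mult mult_left_le)
    qed
    ultimately show ?thesis using True by (simp add: Lim_null_comparison)
  next
    case False
    then have p: "r x > 0" using pos x by force
    have "openin (top_of_set S) (S \<inter> r -` {0<..})"
      using r by (simp add: continuous_openin_preimage_gen)
    then obtain T where T: "open T" "S \<inter> r -` {0<..} = S \<inter> T" by (auto simp: openin_open)
    have e: "{x \<in> S. r x > 0} = S \<inter> T" using T by auto
    have "continuous_on (S \<inter> T) (\<lambda>x. r x * G x)"
      using G r unfolding e by (auto intro!: continuous_on_mult elim: continuous_on_subset)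
    then have "((\<lambda>x. r x * G x) \<longlongrightarrow> r x * G x) (at x within S \<inter> T)"
      using x p T by (auto simp: continuous_on_def)
    moreover have "at x within S \<inter> T = at x within S"
      using T x p by (intro at_within_nhd[of _ T]) auto
    ultimately show ?thesis by simp
  qed
qed

lemma continuous_on_nat_coord: "continuous_on S (\<lambda>x::nat \<Rightarrow> real. x i)"
  by (rule continuous_on_product_then_coordinatewise) simp

definition circle_part :: "nat \<Rightarrow> (nat \<Rightarrow> real) \<Rightarrow> nat \<Rightarrow> real" where
  "circle_part k x = (\<lambda>j::nat. if j < 2 then x (j + k) / sqrt ((x k)\<^sup>2 + (x (Suc k))\<^sup>2) else (0::real))"

lemma circle_part_in_circle: "(x k)\<^sup>2 + (x (Suc k))\<^sup>2 > 0 \<Longrightarrow> circle_part k x \<in> topspace (nsphere 1)"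
  unfolding topspace_nsphere1 by (simp add: circle_part_def power_divide flip: add_divide_distrib) (metis less_irrefl add.right_neutral power_zero_numeral)

lemma join_diff_circle_part: "join_diff f g x i = sqrt ((x 0)\<^sup>2 + (x 1)\<^sup>2) * f (circle_part 0 x) i - sqrt ((x 2)\<^sup>2 + (x 3)\<^sup>2) * g (circle_part 2 x) i"
  by (simp add: join_diff_def circle_part_def Let_def cong: if_cong)

lemma cont_half:
  assumes f: "continuous_map (nsphere 1) (nsphere 3) f"
  shows "continuous_on (topspace (nsphere 3)) (\<lambda>x. sqrt ((x k)\<^sup>2 + (x (Suc k))\<^sup>2) * f (circle_part k x) i)"
proof (rule continuous_on_radial)
  show "continuous_on (topspace (nsphere 3)) (\<lambda>x. sqrt ((x k)\<^sup>2 + (x (Suc k))\<^sup>2))"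
    by (intro continuous_intros continuous_on_nat_coord)
  let ?T = "{x \<in> topspace (nsphere 3). sqrt ((x k)\<^sup>2 + (x (Suc k))\<^sup>2) > 0}"
  have f': "continuous_on (topspace (nsphere 1)) f" "f \<in> topspace (nsphere 1) \<rightarrow> topspace (nsphere 3)"
    using f by (auto simp: nsphere_top_of_set)
  have fi: "continuous_on (topspace (nsphere 1)) (\<lambda>x. f x i)"
    by (rule continuous_on_product_then_coordinatewise[OF f'(1)])
  have "continuous_on ?T (\<lambda>x. circle_part k x j)" for j
    unfolding circle_part_def by (cases "j < 2") (auto intro!: continuous_intros continuous_on_nat_coord simp: sum_power2_eq_zero_iff)
  then have "continuous_on ?T (circle_part k)"
    by (rule continuous_on_coordinatewise_then_product)
  then show "continuous_on ?T (\<lambda>x. f (circle_part k x) i)"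
    by (rule continuous_on_compose2[OF fi]) (use circle_part_in_circle[of _ k] in auto)
  fix x assume "sqrt ((x k)\<^sup>2 + (x (Suc k))\<^sup>2) > 0"
  then have "f (circle_part k x) \<in> topspace (nsphere 3)" using circle_part_in_circle[of x k] f' by auto
  then show "\<bar>f (circle_part k x) i\<bar> \<le> 1"
  proof -
    assume a: "f (circle_part k x) \<in> topspace (nsphere 3)"
    show ?thesis
    proof (cases "i \<le> 3")
      case True
      then have "(f (circle_part k x) i)\<^sup>2 \<le> (\<Sum>i\<le>3. (f (circle_part k x) i)\<^sup>2)"
        by (intro member_le_sum) auto
      then show ?thesis using a by (simp add: nsphere_top_of_set abs_square_le_1)
    qed (use a in \<open>auto simp: topspace_nsphere3\<close>)
  qed
qed auto

lemma join_nz: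
  assumes f: "f \<in> topspace (nsphere 1) \<rightarrow> topspace (nsphere 3)"
    and g: "g \<in> topspace (nsphere 1) \<rightarrow> topspace (nsphere 3)"
    and d: "disjnt (curve_image f) (curve_image g)" and x: "x \<in> topspace (nsphere 3)"
  shows "(\<Sum>j\<le>3. (join_diff f g x j)\<^sup>2) > 0" "i > 3 \<Longrightarrow> join_diff f g x i = 0"
proof -
  define r s where "r = sqrt ((x 0)\<^sup>2 + (x 1)\<^sup>2)" and "s = sqrt ((x 2)\<^sup>2 + (x 3)\<^sup>2)"
  have rs: "r \<ge> 0" "s \<ge> 0" "r\<^sup>2 + s\<^sup>2 = 1" using x by (auto simp: r_def s_def topspace_nsphere3)
  have u: "circle_part 0 x \<in> topspace (nsphere 1)" if "r > 0" using that circle_part_in_circle[of x 0] by (simp add: r_def)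
  have v: "circle_part 2 x \<in> topspace (nsphere 1)" if "s > 0" using that circle_part_in_circle[of x 2] by (simp add: s_def)
  have fu: "f (circle_part 0 x) \<in> topspace (nsphere 3)" if "r > 0" using f u[OF that] by auto
  have gv: "g (circle_part 2 x) \<in> topspace (nsphere 3)" if "s > 0" using g v[OF that] by auto
  have j: "join_diff f g x i = r * f (circle_part 0 x) i - s * g (circle_part 2 x) i" for i
    by (simp add: join_diff_circle_part r_def s_def)
  have z: "r * f (circle_part 0 x) i = 0" "s * g (circle_part 2 x) i = 0" if "i > 3" for i
    using fu gv rs that by (auto simp: topspace_nsphere3 le_less)
  show "join_diff f g x i = 0" if "i > 3" unfolding j z[OF that] by simp
  show "(\<Sum>j\<le>3. (join_diff f g x j)\<^sup>2) > 0"
  proof (rule ccontr)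
    assume "\<not> ?thesis"
    then have "(\<Sum>j\<le>3. (join_diff f g x j)\<^sup>2) = 0"
      by (meson linorder_neqE_linordered_idom not_less sum_nonneg zero_le_power2)
    then have "join_diff f g x i = 0" if "i \<le> 3" for i
      using that by (simp add: sum_nonneg_eq_0_iff)
    then have e: "r * f (circle_part 0 x) i = s * g (circle_part 2 x) i" for i
    proof (cases "i \<le> 3")
      case False
      then have "i > 3" by simp
      show ?thesis unfolding z[OF \<open>i > 3\<close>] ..
    qed (use j[of i] in simp)
    have "(\<Sum>i\<le>3. (r * f (circle_part 0 x) i)\<^sup>2) = r\<^sup>2"
      using fu rs by (cases "r = 0") (auto simp: power_mult_distrib nsphere_top_of_set simp flip: sum_distrib_left)
    moreover have "(\<Sum>i\<le>3. (s * g (circle_part 2 x) i)\<^sup>2) = s\<^sup>2"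
      using gv rs by (cases "s = 0") (auto simp: power_mult_distrib nsphere_top_of_set simp flip: sum_distrib_left)
    ultimately have "r = s" using e rs by simp
    then have p: "r > 0" "s > 0" using rs by (auto simp: le_less)
    then have "f (circle_part 0 x) = g (circle_part 2 x)" using e \<open>r = s\<close> by auto
    then show False using d u v p by (auto simp: curve_image_def disjnt_iff)
  qed
qed

lemma join_map_continuous:
  assumes f: "continuous_map (nsphere 1) (nsphere 3) f" and g: "continuous_map (nsphere 1) (nsphere 3) g"
    and d: "disjnt (curve_image f) (curve_image g)"
  shows "continuous_map (nsphere 3) (nsphere 3) (\<lambda>x. normalise (join_diff f g x))"
proof -
  have f': "f \<in> topspace (nsphere 1) \<rightarrow> topspace (nsphere 3)"
    and g': "g \<in> topspace (nsphere 1) \<rightarrow> topspace (nsphere 3)"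
    using f g by (auto simp: nsphere_top_of_set)
  note nz = join_nz[OF f' g' d]
  let ?S = "topspace (nsphere 3)"
  have c: "continuous_on ?S (\<lambda>x. join_diff f g x i)" for i
    unfolding join_diff_circle_part using cont_half[OF f, of 0 i] cont_half[OF g, of 2 i]
    by (auto intro!: continuous_on_diff simp: eval_nat_numeral)
  have "continuous_on ?S (\<lambda>x. normalise (join_diff f g x) i)" for i
    unfolding normalise_def
    by (intro continuous_intros c) (use nz(1) in force)
  then have "continuous_on ?S (\<lambda>x. normalise (join_diff f g x))"
    by (rule continuous_on_coordinatewise_then_product)
  moreover have "normalise (join_diff f g x) \<in> ?S" if x: "x \<in> ?S" for x
  proof -
    have "(\<Sum>i\<le>3. (normalise (join_diff f g x) i)\<^sup>2) = 1"
      using nz(1)[OF x] by (simp add: normalise_def power_divide flip: sum_divide_distrib)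
    then show ?thesis using nz(2)[OF x] by (simp add: nsphere_top_of_set normalise_def)
  qed
  ultimately show ?thesis by (auto simp: nsphere_top_of_set)
qed

lemma linking_number_sym:
  assumes f: "continuous_map (nsphere 1) (nsphere 3) f" and g: "continuous_map (nsphere 1) (nsphere 3) g"
    and d: "disjnt (curve_image f) (curve_image g)"
  shows "linking_number g f = linking_number f g"
proof -
  let ?A = "\<lambda>(x::nat \<Rightarrow> real) (i::nat). - x i :: real"
  let ?W = "\<lambda>(x::nat \<Rightarrow> real) (i::nat). if i = 0 then x 2 else if i = 1 then x 3 else if i = 2 then x 0 else if i = 3 then x 1
     else (x i :: real)"
  let ?F = "\<lambda>x. normalise (join_diff f g x)"
  let ?h = "\<lambda>(t::real) (x::nat \<Rightarrow> real) (i::nat). if i = 0 then cos (pi * t) * x 0 - sin (pi * t) * x 1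
     else if i = 1 then sin (pi * t) * x 0 + cos (pi * t) * x 1
     else if i = 2 then cos (pi * t) * x 2 - sin (pi * t) * x 3
     else if i = 3 then sin (pi * t) * x 2 + cos (pi * t) * x 3 else (x i :: real)"
  let ?k = "\<lambda>(t::real) (x::nat \<Rightarrow> real) (i::nat). let c = cos (pi / 2 * t); s = sin (pi / 2 * t);
       p = c * x 2 - s * x 0; q = c * x 3 - s * x 1 in
       if i = 0 then c * x 0 + s * x 2
     else if i = 1 then c * x 1 + s * x 3
     else if i = 2 then cos (pi * t) * p - sin (pi * t) * q
     else if i = 3 then sin (pi * t) * p + cos (pi * t) * q else (x i :: real)"
  have rot: "(cos a * p - sin a * q)\<^sup>2 + (sin a * p + cos a * q)\<^sup>2 = p\<^sup>2 + q\<^sup>2" for a p q :: real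
    by (simp add: rot_sq)
  have mix: "(cos a * p + sin a * q)\<^sup>2 + (cos a * q - sin a * p)\<^sup>2 = p\<^sup>2 + q\<^sup>2" for a p q :: real
    by (simp add: rot_sq)
  have ext: "x i = 0" if "x \<in> topspace (nsphere 3)" "i > 3" for x i
    using that by (simp add: topspace_nsphere3)
  have A: "Brouwer_degree2 3 ?A = 1 \<and> continuous_map (nsphere 3) (nsphere 3) ?A"
  proof (rule nsphere3_homotopic_id_degree[where h = ?h])
    fix i show "continuous_on UNIV (\<lambda>p. ?h (fst p) (snd p) i)"
      by (intro cont_if continuous_intros cont_snd)
  next
    fix t :: real and x assume "x \<in> topspace (nsphere 3)"
    then show "?h t x \<in> topspace (nsphere 3)"
      using rot[of "pi*t" "x 0" "x 1"] rot[of "pi*t" "x 2" "x 3"] by (simp add: topspace_nsphere3)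
  next
    fix x :: "nat \<Rightarrow> real" assume x: "x \<in> topspace (nsphere 3)"
    show "?h 0 x = x" by auto
    show "?h 1 x = ?A x"
    proof
      fix i :: nat
      consider "i = 0" | "i = 1" | "i = 2" | "i = 3" | "i > 3" by linarith
      then show "?h 1 x i = ?A x i" using ext[OF x, of i] by cases auto
    qed
  qed
  have kk: "?k t x \<in> topspace (nsphere 3)" if x: "x \<in> topspace (nsphere 3)" for t x
  proof -
    define c s p q where "c = cos (pi/2*t)" and "s = sin (pi/2*t)"
      and "p = c * x 2 - s * x 0" and "q = c * x 3 - s * x 1"
    have 1: "(cos (pi*t) * p - sin (pi*t) * q)\<^sup>2 + (sin (pi*t) * p + cos (pi*t) * q)\<^sup>2 = p\<^sup>2 + q\<^sup>2"
      by (rule rot)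
    have 2: "(c * x 0 + s * x 2)\<^sup>2 + p\<^sup>2 = (x 0)\<^sup>2 + (x 2)\<^sup>2"
      "(c * x 1 + s * x 3)\<^sup>2 + q\<^sup>2 = (x 1)\<^sup>2 + (x 3)\<^sup>2"
      unfolding p_def q_def c_def s_def by (rule mix)+
    have "(x 0)\<^sup>2 + (x 1)\<^sup>2 + (x 2)\<^sup>2 + (x 3)\<^sup>2 = 1" using x by (simp add: topspace_nsphere3)
    then have "(c * x 0 + s * x 2)\<^sup>2 + (c * x 1 + s * x 3)\<^sup>2 + (cos (pi*t) * p - sin (pi*t) * q)\<^sup>2
       + (sin (pi*t) * p + cos (pi*t) * q)\<^sup>2 = 1"
      using 1 2 by linarith
    moreover have "x i = 0" if "i > 3" for i using ext[OF x that] .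
    ultimately show ?thesis
      unfolding topspace_nsphere3 Let_def c_def[symmetric] s_def[symmetric]
        p_def[symmetric] q_def[symmetric] by simp
  qed
  have W: "Brouwer_degree2 3 ?W = 1 \<and> continuous_map (nsphere 3) (nsphere 3) ?W"
  proof (rule nsphere3_homotopic_id_degree[where h = ?k])
    fix i show "continuous_on UNIV (\<lambda>p. ?k (fst p) (snd p) i)"
      unfolding Let_def
      by (intro cont_if continuous_intros cont_snd)
  next
    fix t :: real and x assume "x \<in> topspace (nsphere 3)"
    then show "?k t x \<in> topspace (nsphere 3)" by (rule kk)
  qed (auto simp: Let_def fun_eq_iff)
  note F = join_map_continuous[OF f g d]
  have "normalise (join_diff g f x) = (?A \<circ> (?F \<circ> ?W)) x" for x
  proof -
    have u: "circle_part 0 (?W x) = circle_part 2 x" "circle_part 2 (?W x) = circle_part 0 x"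
      by (auto simp: circle_part_def fun_eq_iff eval_nat_numeral less_Suc_eq)
    have "join_diff f g (?W x) = (\<lambda>i. - join_diff g f x i)"
      unfolding join_diff_circle_part fun_eq_iff u by simp
    then show ?thesis by (simp add: normalise_def)
  qed
  then have "linking_number g f = Brouwer_degree2 3 (?A \<circ> (?F \<circ> ?W))"
    unfolding linking_number_def by (metis)
  also have "\<dots> = Brouwer_degree2 3 ?F"
    using conjunct1[OF A] conjunct1[OF W]
      Brouwer_degree2_compose[OF continuous_map_compose[OF conjunct2[OF W] F] conjunct2[OF A]]
      Brouwer_degree2_compose[OF conjunct2[OF W] F] by (simp only: mult_1 mult_1_right)
  finally show ?thesis by (simp add: linking_number_def)
qed

lemma linking_matrix_symmetric:
  assumes "link L"
  shows "transpose_mat (linking_matrix L) = linking_matrix L"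
proof -
  have "continuous_map (nsphere 1) (nsphere 3) (L ! i)" if "i < length L" for i
    using assms that
    by (auto simp: link_def knot_def embedding_map_def continuous_map_in_subtopology
        dest!: homeomorphic_imp_continuous_map bspec[OF _ nth_mem])
  then show ?thesis
    using assms by (intro eq_matI) (auto simp: linking_matrix_def link_def intro!: linking_number_sym)
qed


section \<open>The total Milnor quotient\<close>

text \<open>
  The third exterior power of \<open>\<int>\<^sup>n\<close> is represented as the free abelian group on its basis
  \<open>e\<^sub>i \<and> e\<^sub>j \<and> e\<^sub>k\<close>, \<open>i < j < k\<close>. All indices start at 0.
\<close>

definition exterior_cube :: "nat \<Rightarrow> (nat \<times> nat \<times> nat \<Rightarrow>\<^sub>0 int) monoid" where
  "exterior_cube n = free_Abelian_group {(i, j, k). i < j \<and> j < k \<and> k < n}"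

text \<open>The trivector \<open>e\<^sub>i \<and> e\<^sub>j \<and> e\<^sub>k\<close> for arbitrary \<open>i\<close>, \<open>j\<close>, \<open>k\<close>, expressed in that basis.\<close>

definition wedge3 :: "nat \<Rightarrow> nat \<Rightarrow> nat \<Rightarrow> (nat \<times> nat \<times> nat \<Rightarrow>\<^sub>0 int)" where
  "wedge3 i j k =
     (if i < j \<and> j < k then frag_of (i, j, k)
      else if j < k \<and> k < i then frag_of (j, k, i)
      else if k < i \<and> i < j then frag_of (k, i, j)
      else if j < i \<and> i < k then - frag_of (j, i, k)
      else if i < k \<and> k < j then - frag_of (i, k, j)
      else if k < j \<and> j < i then - frag_of (k, j, i)
      else 0)"

lemma wedge3_alternating:
  "wedge3 j i k = - wedge3 i j k" "wedge3 i k j = - wedge3 i j k"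
  "wedge3 i i k = 0" "wedge3 i k k = 0" "wedge3 i k i = 0"
  by (auto simp: wedge3_def)

definition milnor_relator :: "int mat \<Rightarrow> nat \<Rightarrow> nat \<Rightarrow> (nat \<times> nat \<times> nat \<Rightarrow>\<^sub>0 int)" where
  "milnor_relator A j k = (\<Sum>i<dim_row A. frag_cmul (A $$ (i, k)) (wedge3 i j k))"

definition milnor_relations :: "int mat \<Rightarrow> (nat \<times> nat \<times> nat \<Rightarrow>\<^sub>0 int) set" where
  "milnor_relations A = generate (exterior_cube (dim_row A))
     {milnor_relator A j k | j k. j < dim_row A \<and> k < dim_row A \<and> j \<noteq> k}"

definition total_milnor_quotient :: "int mat \<Rightarrow> (nat \<times> nat \<times> nat \<Rightarrow>\<^sub>0 int) set monoid" where
  "total_milnor_quotient A = exterior_cube (dim_row A) Mod milnor_relations A"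

end

theory Submission
  imports Defs
begin

text \<open>
  The linking matrix of the sublink is the principal submatrix of the linking matrix of the link on
  the indices of the components that are kept. Let the projection \<open>\<int>\<^sup>n \<rightarrow> \<int>\<^sup>m\<close> kill the basis
  vectors of the dropped components and rename the others. Its third exterior power \<open>P\<close> is
  surjective. It kills a relator \<open>v\<^sub>j\<^sub>k\<close> if component \<open>j\<close> or \<open>k\<close> is dropped, because every term of
  \<open>v\<^sub>j\<^sub>k\<close> contains \<open>e\<^sub>j \<and> e\<^sub>k\<close>. If both are kept, the terms of \<open>v\<^sub>j\<^sub>k\<close> that survive are those whose
  index \<open>i\<close> is kept, and they form the relator of the submatrix for the renamed pair. Hence \<open>P\<close>
  carries relations to relations and descends to the quotients
  (\<open>epi_total_milnor_quotient_submatrix\<close>).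

  Since \<open>P\<close> is given by an alternating function of three indices (\<open>frag_extend_wedge3\<close>), it is
  compatible with every reordering of the indices, so an injective renaming suffices.
\<close>

section \<open>Maps induced on quotient groups\<close>

lemma epi_FactGroup:
  assumes G: "group G" and M: "M \<lhd> G" and N: "N \<lhd> H"
    and h: "h \<in> epi G H" and sub: "h ` M \<subseteq> N"
  shows "\<exists>\<phi>. \<phi> \<in> epi (G Mod M) (H Mod N)"
proof -
  interpret N: normal N H by (rule N)
  let ?q = "\<lambda>x. N #>\<^bsub>H\<^esub> h x"
  have "h \<in> hom G H" using h by (simp add: epi_def)
  from hom_compose[OF this N.r_coset_hom_Mod] have q: "?q \<in> hom G (H Mod N)"
    by (simp add: o_def)
  interpret q: group_hom G "H Mod N" ?q
    using G N.factorgroup_is_group q by (simp add: group_hom_def group_hom_axioms_def)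
  have "?q x = N" if "x \<in> M" for x
    using sub that N.subgroup_axioms by (intro N.rcos_const N.is_group) auto
  moreover have "M \<subseteq> carrier G"
    using M by (meson normal_imp_subgroup subgroup.subset)
  ultimately have "M \<subseteq> kernel G (H Mod N) ?q"
    by (auto simp: kernel_def)
  then obtain \<phi> where \<phi>: "\<phi> \<in> hom (G Mod M) (H Mod N)"
      "\<And>x. x \<in> carrier G \<Longrightarrow> \<phi> (M #>\<^bsub>G\<^esub> x) = ?q x"
    using q.FactGroup_universal_kernel[OF M] by blast
  have "\<phi> ` carrier (G Mod M) = (\<lambda>y. N #>\<^bsub>H\<^esub> y) ` h ` carrier G"
    by (simp add: carrier_FactGroup image_image \<phi>(2))
  also have "\<dots> = carrier (H Mod N)"
    using h by (simp add: epi_def carrier_FactGroup)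
  finally show ?thesis using \<phi>(1) by (auto simp: epi_def)
qed


section \<open>The exterior cube and the Milnor relations\<close>

lemma keys_wedge3:
  assumes "i < n" "j < n" "k < n"
  shows "Poly_Mapping.keys (wedge3 i j k) \<subseteq> {(i, j, k). i < j \<and> j < k \<and> k < n}"
  using assms by (auto simp: wedge3_def)

text \<open>
  A homomorphism out of the exterior cube is prescribed on increasing triples only; alternation is
  what makes the prescribed formula valid for the trivectors of all triples.
\<close>

lemma frag_extend_wedge3:
  assumes "\<And>i j k. q j i k = - q i j k" "\<And>i j k. q i k j = - q i j k"
    and "\<And>i k. q i i k = 0"
  shows "frag_extend (\<lambda>(i, j, k). q i j k) (wedge3 i j k) = q i j k"
proof -
  have cyc: "q j k i = q i j k" "q k i j = q i j k" "q k j i = - q i j k" for i j k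
    using assms(1,2) by (metis minus_minus)+
  have diag: "q i k k = 0" "q i k i = 0" for i k
    using assms(3) cyc(1) by metis+
  consider "i = j \<or> j = k \<or> i = k" | "i < j" "j < k" | "j < k" "k < i" | "k < i" "i < j"
    | "j < i" "i < k" | "i < k" "k < j" | "k < j" "j < i" by linarith
  then show ?thesis
  proof cases
    case 1
    then show ?thesis using assms(3) diag by (auto simp: wedge3_alternating(3-5))
  qed (use assms(1)[of j i k] assms(2)[of i k j] cyc[of j k i] cyc[of i j k] in
        \<open>simp_all add: wedge3_def frag_extend_minus\<close>)
qed

lemma comm_group_exterior_cube: "comm_group (exterior_cube n)"
  unfolding exterior_cube_def by (rule abelian_free_Abelian_group)

lemma milnor_relator_closed:
  assumes "j < dim_row A" "k < dim_row A"
  shows "milnor_relator A j k \<in> carrier (exterior_cube (dim_row A))"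
  unfolding milnor_relator_def exterior_cube_def
proof (rule sum_closed_free_Abelian_group)
  fix i assume "i \<in> {..<dim_row A}"
  then show "frag_cmul (A $$ (i, k)) (wedge3 i j k)
      \<in> carrier (free_Abelian_group {(i, j, k). i < j \<and> j < k \<and> k < dim_row A})"
    using assms keys_cmul[of "A $$ (i, k)" "wedge3 i j k"] keys_wedge3[of i "dim_row A" j k] by auto
qed

lemma normal_milnor_relations: "milnor_relations A \<lhd> exterior_cube (dim_row A)"
proof -
  interpret comm_group "exterior_cube (dim_row A)" by (rule comm_group_exterior_cube)
  show ?thesis
    unfolding milnor_relations_def
    by (intro subgroup_imp_normal generate_is_subgroup) (auto intro: milnor_relator_closed)
qed


section \<open>Principal submatrices\<close>

text \<open>
  Dropping the trivectors with an index outside the range of \<open>f\<close> turns each relator of \<open>A\<close> into a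
  relator of \<open>B\<close> or into \<open>0\<close>.
\<close>

lemma epi_total_milnor_quotient_submatrix:
  fixes A B :: "int mat"
  assumes inj: "inj_on f {..<dim_row B}" and f: "f ` {..<dim_row B} \<subseteq> {..<dim_row A}"
    and B: "\<And>i j. i < dim_row B \<Longrightarrow> j < dim_row B \<Longrightarrow> B $$ (i, j) = A $$ (f i, f j)"
  shows "\<exists>\<phi>. \<phi> \<in> epi (total_milnor_quotient A) (total_milnor_quotient B)"
proof -
  let ?n = "dim_row A" and ?m = "dim_row B"
  let ?G = "exterior_cube ?n" and ?H = "exterior_cube ?m"
  define g where "g = inv_into {..<?m} f"
  \<comment> \<open>the image of \<open>e\<^sub>i \<and> e\<^sub>j \<and> e\<^sub>k\<close> when \<open>e\<^bsub>f a\<^esub>\<close> goes to \<open>e\<^sub>a\<close> and the other basis vectors to \<open>0\<close>\<close>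
  define q where "q i j k = (if {i, j, k} \<subseteq> f ` {..<?m} then wedge3 (g i) (g j) (g k) else 0)" for i j k
  define P where "P = frag_extend (\<lambda>(i, j, k). q i j k)"
  interpret G: comm_group ?G by (rule comm_group_exterior_cube)
  interpret H: comm_group ?H by (rule comm_group_exterior_cube)
  have gf: "g (f i) = i" if "i < ?m" for i
    using inj that by (simp add: g_def)
  have P_wedge3: "P (wedge3 i j k) = q i j k" for i j k
    unfolding P_def
  proof (rule frag_extend_wedge3)
    fix i j k
    show "q j i k = - q i j k"
      using wedge3_alternating(1)[of "g j" "g i" "g k"] by (auto simp: q_def)
    show "q i k j = - q i j k"
      using wedge3_alternating(2)[of "g i" "g k" "g j"] by (auto simp: q_def)
    show "q i i k = 0"
      by (simp add: q_def wedge3_alternating(3))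
  qed
  have q_f: "q (f i) (f j) (f k) = wedge3 i j k" if "i < ?m" "j < ?m" "k < ?m" for i j k
    using that by (simp add: q_def gf)
  have q_keys: "Poly_Mapping.keys (q i j k) \<subseteq> {(i, j, k). i < j \<and> j < k \<and> k < ?m}" for i j k
  proof (cases "{i, j, k} \<subseteq> f ` {..<?m}")
    case True
    then obtain i' j' k' where "i = f i'" "j = f j'" "k = f k'" "i' < ?m" "j' < ?m" "k' < ?m"
      by auto
    then show ?thesis using keys_wedge3[of i' ?m j' k'] by (simp add: q_f)
  qed (auto simp: q_def)

  have "P \<in> hom ?G ?H"
  proof (rule homI)
    fix x y
    have "Poly_Mapping.keys (P x) \<subseteq> {(i, j, k). i < j \<and> j < k \<and> k < ?m}"
      unfolding P_def by (rule order_trans[OF keys_frag_extend]) (use q_keys in fast)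
    then show "P x \<in> carrier ?H" by (simp add: exterior_cube_def)
    show "P (x \<otimes>\<^bsub>?G\<^esub> y) = P x \<otimes>\<^bsub>?H\<^esub> P y"
      by (simp add: exterior_cube_def P_def frag_extend_add)
  qed
  then interpret P: group_hom ?G ?H P
    by unfold_locales

  have "y \<in> P ` carrier ?G" if "y \<in> carrier ?H" for y
    using that[unfolded exterior_cube_def carrier_free_Abelian_group_iff]
  proof (rule free_Abelian_group_induct)
    show "0 \<in> P ` carrier ?G"
      by (rule image_eqI[of _ _ 0]) (auto simp: P_def exterior_cube_def)
  next
    fix x y
    assume "x \<in> P ` carrier ?G" "y \<in> P ` carrier ?G"
    then obtain u v where "x = P u" "y = P v" "u \<in> carrier ?G" "v \<in> carrier ?G"
      by blast
    then show "x - y \<in> P ` carrier ?G"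
      using keys_diff[of u v]
      by (intro image_eqI[of _ _ "u - v"]) (auto simp: P_def frag_extend_diff exterior_cube_def)
  next
    fix a assume "a \<in> {(i, j, k). i < j \<and> j < k \<and> k < ?m}"
    then obtain i j k where a: "a = (i, j, k)" "i < j" "j < k" "k < ?m" by auto
    have "P (wedge3 (f i) (f j) (f k)) = frag_of a"
      using a by (simp add: P_wedge3 q_f) (simp add: wedge3_def)
    moreover have "wedge3 (f i) (f j) (f k) \<in> carrier ?G"
      using a f keys_wedge3[of "f i" ?n "f j" "f k"]
      by (simp add: exterior_cube_def image_subset_iff)
    ultimately show "frag_of a \<in> P ` carrier ?G"
      by (metis image_eqI)
  qed
  then have epi: "P \<in> epi ?G ?H"
    using P.homh P.hom_closed by (auto simp: epi_def)

  have P_relator: "P (milnor_relator A j k) = (\<Sum>i<?n. frag_cmul (A $$ (i, k)) (q i j k))" for j k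
    by (simp add: milnor_relator_def frag_extend_sum o_def frag_extend_cmul P_wedge3[unfolded P_def] P_def)
  have "P (milnor_relator A j k) \<in> milnor_relations B"
    if jk: "j < ?n" "k < ?n" "j \<noteq> k" for j k
  proof (cases "j \<in> f ` {..<?m} \<and> k \<in> f ` {..<?m}")
    case True
    then obtain j' k' where *: "j = f j'" "k = f k'" "j' < ?m" "k' < ?m" by auto
    have "P (milnor_relator A j k) = (\<Sum>i\<in>f ` {..<?m}. frag_cmul (A $$ (i, k)) (q i j k))"
      unfolding P_relator using f by (intro sum.mono_neutral_right) (auto simp: q_def)
    also have "\<dots> = milnor_relator B j' k'"
      unfolding milnor_relator_def sum.reindex[OF inj] by (simp add: * q_f B)
    finally show ?thesis
      using * jk unfolding milnor_relations_def by (auto intro!: generate.incl)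
  next
    case False
    then have "P (milnor_relator A j k) = 0"
      unfolding P_relator by (auto simp: q_def intro!: sum.neutral)
    then show ?thesis
      using generate.one[of ?H] by (simp add: milnor_relations_def exterior_cube_def)
  qed
  then have "P ` {milnor_relator A j k | j k. j < ?n \<and> k < ?n \<and> j \<noteq> k} \<subseteq> milnor_relations B"
    by auto
  then have "generate ?H (P ` {milnor_relator A j k | j k. j < ?n \<and> k < ?n \<and> j \<noteq> k})
      \<subseteq> milnor_relations B"
    by (rule H.generate_subgroup_incl) (rule normal_imp_subgroup[OF normal_milnor_relations])
  moreover have "P ` milnor_relations A
      = generate ?H (P ` {milnor_relator A j k | j k. j < ?n \<and> k < ?n \<and> j \<noteq> k})"
    unfolding milnor_relations_def
    by (rule P.generate_img[symmetric]) (auto intro: milnor_relator_closed)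
  ultimately have "P ` milnor_relations A \<subseteq> milnor_relations B"
    by simp
  then show ?thesis
    unfolding total_milnor_quotient_def
    using epi_FactGroup[OF G.is_group normal_milnor_relations normal_milnor_relations epi] by blast
qed


section \<open>Sublinks\<close>

lemma subseq_index_embedding:
  assumes "subseq xs ys"
  shows "\<exists>f. inj_on f {..<length xs} \<and> f ` {..<length xs} \<subseteq> {..<length ys} \<and>
    (\<forall>i<length xs. xs ! i = ys ! f i)"
  using assms
proof (induction rule: list_emb.induct)
  case (list_emb_Nil ys)
  show ?case by simp
next
  case (list_emb_Cons xs ys y)
  then obtain f where "inj_on f {..<length xs}" "f ` {..<length xs} \<subseteq> {..<length ys}"
    "\<forall>i<length xs. xs ! i = ys ! f i" by blast
  then show ?case
    by (intro exI[of _ "Suc \<circ> f"]) (auto simp: inj_on_def image_subset_iff)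
next
  case (list_emb_Cons2 x y xs ys)
  then obtain f where "inj_on f {..<length xs}" "f ` {..<length xs} \<subseteq> {..<length ys}"
    "\<forall>i<length xs. xs ! i = ys ! f i" by blast
  then show ?case using \<open>x = y\<close>
    by (intro exI[of _ "case_nat 0 (Suc \<circ> f)"])
       (auto simp: inj_on_def image_subset_iff nth_Cons split: nat.split)
qed

theorem proposition1p7:
  fixes L L' :: "curve list"
  assumes "link L" and "sublink L' L"
  shows "\<exists>\<phi>. \<phi> \<in> epi (total_milnor_quotient (linking_matrix L))
                  (total_milnor_quotient (linking_matrix L'))"
proof -
  obtain f where inj: "inj_on f {..<length L'}" and f: "f ` {..<length L'} \<subseteq> {..<length L}"
    and L': "\<forall>i<length L'. L' ! i = L ! f i"
    using subseq_index_embedding assms(2) unfolding sublink_def by blast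
  show ?thesis
  proof (rule epi_total_milnor_quotient_submatrix)
    fix i j assume "i < dim_row (linking_matrix L')" "j < dim_row (linking_matrix L')"
    \<comment> \<open>by injectivity, diagonal entries, which are \<open>0\<close> by convention, correspond to diagonal entries\<close>
    then show "linking_matrix L' $$ (i, j) = linking_matrix L $$ (f i, f j)"
      using f L' inj_on_eq_iff[OF inj, of i j] by (auto simp: linking_matrix_def image_subset_iff)
  qed (use inj f in \<open>simp_all add: linking_matrix_def\<close>)
qed

end
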